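(* Suppose $\mu$ is a singular cardinal which is a limit of measurable cardinals. Then: 1. $$\left( \begin{array}{c} \mu^+ \\ \mu \end{array} \right)\rightarrow \left( \begin{array}{c} \mu \\ \mu \end{array}\right)^{1,1}_\theta$$ if $\theta=2$, or at least if $\theta<\mathrm{cf}(\mu)$. 2. Moreover, if $\alpha^*<\mu^+$ and $\theta<\mathrm{cf}(\mu)$, then $$\left( \begin{array}{c} \mu^+ \\ \mu \end{array} \right)\rightarrow \left( \begin{array}{c} \alpha^* \\ \mu \end{array}\right)^{1,1}_\theta.$$ 3. If $\theta<\mu$, $\alpha^*< \mu^+$ and $d$ is a function from $\mu^+\times \mu$ to $\theta$, then for some $A\subseteq \mu^+$ with $\mathrm{otp}(A)=\alpha^*$ and some $B=\bigcup_{i< \mathrm{cf}(\mu)} B_i\subseteq\mu$ we have: $d\restriction (A\times B_i)$ is constant for each $i<\mathrm{cf}(\mu)$.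
   Context: For ordinals $\alpha_1,\alpha_2,\beta_1,\beta_2$ and a cardinal $\theta$, the polarized partition symbol $$\left( \begin{array}{c} \alpha_1 \\ \beta_1 \end{array}\right) \rightarrow \left( \begin{array}{c} \alpha_2 \\ \beta_2\end{array} \right)^{1,1}_{\theta}$$ means: if $d$ is a function from $\alpha_1\times \beta_1$ into $\theta$, then for some $A\subseteq \alpha_1$ of order type $\alpha_2$ and $B\subseteq \beta_1$ of order type $\beta_2$, the function $d\restriction (A\times B)$ is constant. Throughout, $\theta$ is a cardinal and $\alpha^*$ is an ordinal; $\mathrm{otp}(X)$ denotes the order type of a set of ordinals $X$, $\mathrm{cf}(\mu)$ is the cofinality of $\mu$, and $\mu^+$ is the successor cardinal of $\mu$. *)

theory Defs
  imports Main "HOL-Library.FuncSet"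
begin

(* Ordinals are represented by well-orders (relations satisfying Well_order), up to the
   isomorphism =o; cardinals are the well-orders satisfying Card_order. The points of an ordinal r
   are the elements of Field r, and a set A of such points has order type s iff Restr r A =o s. *)

unbundle cardinal_syntax

(* The library's cofinal K r asks for an element of K strictly above each point of r, so the value
   is meaningful only for r without a last element, in particular for infinite cardinals. *)
definition cofinality :: "'a rel \<Rightarrow> 'a rel" where
  "cofinality r = |SOME K. K \<subseteq> Field r \<and> cofinal K r \<and>
     (\<forall>L. L \<subseteq> Field r \<and> cofinal L r \<longrightarrow> |K| \<le>o |L| )|"

definition singular_cardinal :: "'a rel \<Rightarrow> bool" where
  "singular_cardinal r \<longleftrightarrow> Card_order r \<and> infinite (Field r) \<and> cofinality r <o r"

definition nonprincipal_ultrafilter_on :: "'a set \<Rightarrow> 'a set set \<Rightarrow> bool" where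
  "nonprincipal_ultrafilter_on X U \<longleftrightarrow>
     U \<subseteq> Pow X \<and> X \<in> U \<and> {} \<notin> U \<and>
     (\<forall>A B. A \<in> U \<and> A \<subseteq> B \<and> B \<subseteq> X \<longrightarrow> B \<in> U) \<and>
     (\<forall>A B. A \<in> U \<and> B \<in> U \<longrightarrow> A \<inter> B \<in> U) \<and>
     (\<forall>A. A \<subseteq> X \<longrightarrow> A \<in> U \<or> X - A \<in> U) \<and>
     (\<forall>x\<in>X. {x} \<notin> U)"

definition complete_family :: "'k rel \<Rightarrow> 'a set set \<Rightarrow> bool" where
  "complete_family r U \<longleftrightarrow> (\<forall>S. S \<subseteq> U \<and> S \<noteq> {} \<and> |S| <o r \<longrightarrow> \<Inter>S \<in> U)"

definition measurable_cardinal :: "'a rel \<Rightarrow> bool" where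
  "measurable_cardinal r \<longleftrightarrow> Card_order r \<and> natLeq <o r \<and>
     (\<exists>U. nonprincipal_ultrafilter_on (Field r) U \<and> complete_family r U)"

(* Every ordinal below r is isomorphic to a well-order on a subset of Field r, so it is no
   restriction that s and k range over relations on the same type as r. *)
definition limit_of_measurables :: "'a rel \<Rightarrow> bool" where
  "limit_of_measurables r \<longleftrightarrow>
     (\<forall>s::'a rel. s <o r \<longrightarrow> (\<exists>k::'a rel. measurable_cardinal k \<and> s <o k \<and> k <o r))"

definition const_on :: "('a \<Rightarrow> 'b) \<Rightarrow> 'a set \<Rightarrow> bool" where
  "const_on f X \<longleftrightarrow> (\<exists>c. \<forall>x\<in>X. f x = c)"

definition polarized_partition ::
    "'a rel \<Rightarrow> 'b rel \<Rightarrow> 'c rel \<Rightarrow> 'd rel \<Rightarrow> 'e rel \<Rightarrow> bool" where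
  "polarized_partition \<alpha>1 \<beta>1 \<alpha>2 \<beta>2 \<theta> \<longleftrightarrow>
     (\<forall>d. d \<in> Field \<alpha>1 \<times> Field \<beta>1 \<rightarrow> Field \<theta> \<longrightarrow>
        (\<exists>A B. A \<subseteq> Field \<alpha>1 \<and> Restr \<alpha>1 A =o \<alpha>2 \<and>
               B \<subseteq> Field \<beta>1 \<and> Restr \<beta>1 B =o \<beta>2 \<and>
               const_on d (A \<times> B)))"

end

theory Submission
  imports Defs
begin

text \<open>
  Let \<open>K\<close> be a cofinal subset of \<open>\<mu>\<close> of least cardinality. For every \<open>i \<in> K\<close> choose a
  measurable cardinal \<open>M i\<close> below \<open>\<mu>\<close> which exceeds the cardinality of the set of points below \<open>i\<close>,
  of \<open>K\<close> and of the set of colours, with a complete nonprincipal ultrafilter \<open>U i\<close>, and inject \<open>M i\<close>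
  into \<open>\<mu>\<close>. For a point \<open>b\<close> of \<open>\<mu>\<^sup>+\<close>, the map \<open>x \<mapsto> d (b, x)\<close> takes some colour \<open>c b i\<close> on a set
  in \<open>U i\<close>.

  Measurable cardinals are strong limits (\<open>measurable_cardinal_Pow\<close>), and so is \<open>\<mu>\<close>. Hence,
  for each \<open>j \<in> K\<close>, there are fewer than \<open>\<mu>\<close> possibilities for the pair formed by the
  whole function \<open>c b\<close> and the restriction of \<open>x \<mapsto> d (b, x)\<close> to those \<open>M i\<close> that are at most as large
  as the set of points below \<open>j\<close>. Call this pair the \<open>j\<close>-code of \<open>b\<close>. At most \<open>\<mu>\<close> many points have, for
  some \<open>j\<close>, a \<open>j\<close>-code shared by at most \<open>\<mu>\<close> points. So there is a point \<open>a\<close> that, for every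
  \<open>j \<in> K\<close>, shares its \<open>j\<close>-code with more than \<open>\<mu>\<close> points (\<open>ex_point_with_large_classes\<close>).

  Write \<open>\<alpha>\<close> as a union of sets \<open>E j\<close>, for \<open>j \<in> K\<close>, where \<open>E j\<close> is at most as large as the set of points below
  \<open>j\<close>. By recursion along \<open>\<alpha>\<close>, choose strictly increasing points \<open>g e\<close> such that, for \<open>e \<in> E j\<close>, the
  points \<open>g e\<close> and \<open>a\<close> have the same \<open>j\<close>-code (\<open>ex_increasing_selection\<close>). The range of \<open>g\<close> is \<open>A\<close>.
  Now fix \<open>i \<in> K\<close>. If \<open>M i\<close> is at most as large as the set of points below \<open>j\<close>, then \<open>g e\<close> and \<open>a\<close>
  induce the same colouring of \<open>M i\<close> for every \<open>e \<in> E j\<close>. There are at most \<open>|K| < M i\<close> many other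
  \<open>j\<close>, and for each of them \<open>|E j| < M i\<close>. So completeness of \<open>U i\<close> yields a set in \<open>U i\<close> on which every
  \<open>g e\<close> takes the colour \<open>c a i\<close>. Its image in \<open>\<mu>\<close> is \<open>B i\<close>, which has the cardinality of \<open>M i\<close>
  (\<open>simultaneous_homogeneous_sets\<close>). The union of the \<open>B i\<close> therefore has cardinality \<open>\<mu>\<close>, hence
  order type \<open>\<mu>\<close>.

  If there are fewer colours than the cofinality of \<open>\<mu>\<close>, then one colour class in this union has
  cardinality \<open>\<mu>\<close> (\<open>ex_member_of_full_card\<close>). The case of order type \<open>\<mu>\<close> is the instance \<open>\<alpha> = \<mu>\<close>,
  and two colours are fewer than the cofinality because a cofinal set is infinite.
\<close>

section \<open>Well-orders and cardinals\<close>

lemma ordLess_card_of_underS: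
  assumes "Card_order r" and "|A| <o r"
  shows "\<exists>a\<in>Field r. |A| =o |underS r a|"
proof -
  have wo: "Well_order r"
    using assms(1) unfolding card_order_on_def by blast
  obtain a where a: "a \<in> Field r" "|A| =o Restr r (underS r a)"
    using assms(2) ordLess_iff_ordIso_Restr[OF wo card_of_Well_order] by blast
  have "Restr r (underS r a) =o |Field (Restr r (underS r a))|"
    using a(2) card_of_Card_order Card_order_ordIso2 Card_order_iff_ordIso_card_of by blast
  moreover have "Field (Restr r (underS r a)) = underS r a"
    using well_order_on_Restr[OF wo Order_Relation.underS_Field] well_order_on_Field by metis
  ultimately show ?thesis
    using a ordIso_transitive by metis
qed

lemma card_of_under:
  assumes "Card_order r" and "infinite (Field r)" and "a \<in> Field r"
  shows "|under r a| <o r"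
proof -
  obtain b where b: "b \<in> Field r" "a \<noteq> b" "(a, b) \<in> r"
    using infinite_Card_order_limit[OF assms] by blast
  have "trans r" "antisym r"
    using assms(1) unfolding card_order_on_def order_on_defs by blast+
  hence "under r a \<subseteq> underS r b"
    using b unfolding under_def underS_def trans_def antisym_def by blast
  thus ?thesis
    using card_of_mono1 card_of_underS[OF assms(1) b(1)] ordLeq_ordLess_trans by blast
qed

text \<open>
  A proper initial segment of \<open>B\<close> lies below some point of \<open>r\<close>, so it has fewer than \<open>r\<close> elements. Hence
  the order type of \<open>B\<close> cannot exceed \<open>r\<close>.
\<close>
lemma Restr_ordIso_if_card_of_ordIso:
  assumes r: "Card_order r" and B: "B \<subseteq> Field r" "|B| =o r"
  shows "Restr r B =o r"
proof -
  have wo: "Well_order r"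
    using r unfolding card_order_on_def by blast
  have woB: "well_order_on B (Restr r B)"
    by (rule well_order_on_Restr[OF wo B(1)])
  hence woB': "Well_order (Restr r B)" and FB: "Field (Restr r B) = B"
    using well_order_on_Well_order[OF woB] by auto
  have "r \<le>o Restr r B"
    using card_of_least[OF woB] B(2) ordIso_ordLeq_trans ordIso_symmetric by blast
  moreover have "\<not> r <o Restr r B"
  proof
    assume "r <o Restr r B"
    then obtain b where b: "b \<in> B" "r =o Restr (Restr r B) (underS (Restr r B) b)"
      using ordLess_iff_ordIso_Restr[OF woB' wo] FB by blast
    let ?S = "underS (Restr r B) b"
    have "well_order_on ?S (Restr (Restr r B) ?S)"
      by (rule well_order_on_Restr[OF woB' Order_Relation.underS_Field])
    hence "Field (Restr (Restr r B) ?S) = ?S"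
      using well_order_on_Field by metis
    hence "|Field r| \<le>o |?S|"
      using card_of_mono2 b(2) ordIso_iff_ordLeq by metis
    hence "r \<le>o |?S|"
      using card_of_Field_ordIso[OF r] ordIso_ordLeq_trans ordIso_symmetric by blast
    also have "|?S| \<le>o |underS r b|"
      by (rule card_of_mono1) (auto simp: underS_def)
    also have "|underS r b| <o r"
      using card_of_underS[OF r] b(1) B(1) by blast
    finally show False
      using ordLess_irreflexive by blast
  qed
  ultimately show ?thesis
    using ordLeq_iff_ordLess_or_ordIso ordIso_symmetric by blast
qed

text \<open>
  Given at most \<open>r\<close> many points of \<open>r\<^sup>+\<close>, a set with more than \<open>r\<close> elements has an element above all
  of them. So an increasing sequence of any length below \<open>r\<^sup>+\<close> can be chosen whose \<open>e\<close>-th term lies in a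
  prescribed set \<open>S e\<close> of this kind. The sets \<open>S e\<close> may vary with \<open>e\<close> in an arbitrary manner.
\<close>
lemma ex_increasing_selection:
  assumes r: "Card_order r" "infinite (Field r)"
    and \<alpha>: "Well_order \<alpha>" "\<alpha> <o cardSuc r"
    and S: "\<And>e. e \<in> Field \<alpha> \<Longrightarrow> S e \<subseteq> Field (cardSuc r) \<and> \<not> |S e| \<le>o r"
  shows "\<exists>g. (\<forall>e\<in>Field \<alpha>. g e \<in> S e) \<and> Restr (cardSuc r) (g ` Field \<alpha>) =o \<alpha>"
proof -
  let ?s = "cardSuc r"
  have s: "Card_order ?s"
    by (rule cardSuc_Card_order[OF r(1)])
  hence ws: "Well_order ?s"
    unfolding card_order_on_def by blast
  have inf_s: "infinite (Field ?s)"
    using cardSuc_finite r by blast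
  have le_r: "|A| \<le>o r" if "|A| <o ?s" for A :: "'x set"
    using that cardSuc_ordLeq_ordLess[OF r(1) card_of_Card_order] by blast
  have wr: "wo_rel \<alpha>"
    using \<alpha>(1) unfolding wo_rel_def .
  define H where
    "H f e = (SOME x. x \<in> S e \<and> (\<forall>z\<in>underS \<alpha> e. f z \<noteq> x \<and> (f z, x) \<in> ?s))" for f e
  define g where "g = wo_rel.worec \<alpha> H"
  have "wo_rel.adm_wo \<alpha> H"
    unfolding wo_rel.adm_wo_def[OF wr] H_def by auto
  hence g_rec: "g e = H g e" for e
    using wo_rel.worec_fixpoint[OF wr] unfolding g_def by metis
  have g: "g e \<in> S e \<and> (\<forall>z\<in>underS \<alpha> e. g z \<noteq> g e \<and> (g z, g e) \<in> ?s)"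
    if "e \<in> Field \<alpha>" for e
    using that
  proof (induction e rule: wo_rel.well_order_induct[OF wr])
    case (1 e)
    have gS: "g z \<in> Field ?s" if "z \<in> underS \<alpha> e" for z
      using that 1(1) S unfolding underS_def Field_def by blast
    have "|underS \<alpha> e| \<le>o |Field \<alpha>|"
      by (rule card_of_mono1[OF Order_Relation.underS_Field])
    also have "|Field \<alpha>| \<le>o r"
      using le_r ordLess_Field[OF \<alpha>(2)] by blast
    finally have card_preds: "|underS \<alpha> e| \<le>o r" .
    \<comment> \<open>The points not above all earlier choices form a union of at most \<open>r\<close> many sets of size at most \<open>r\<close>.\<close>
    have "\<forall>z\<in>underS \<alpha> e. |under ?s (g z)| \<le>o r"
      using card_of_under[OF s inf_s gS] by (intro ballI le_r)
    hence "|\<Union>z\<in>underS \<alpha> e. under ?s (g z)| \<le>o r"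
      by (rule card_of_UNION_ordLeq_infinite_Field[OF r(2,1) card_preds])
    moreover have "\<not> |S e| \<le>o r"
      using S 1(2) by blast
    ultimately have "\<not> S e \<subseteq> (\<Union>z\<in>underS \<alpha> e. under ?s (g z))"
      using card_of_mono1 ordLeq_transitive by blast
    then obtain x where x: "x \<in> S e" "\<And>z. z \<in> underS \<alpha> e \<Longrightarrow> (x, g z) \<notin> ?s"
      unfolding under_def by blast
    have xF: "x \<in> Field ?s"
      using x(1) S 1(2) by blast
    have "g z \<noteq> x \<and> (g z, x) \<in> ?s" if z: "z \<in> underS \<alpha> e" for z
      using x(2)[OF z] gS[OF z] xF wo_rel.TOTALS[of ?s] ws unfolding wo_rel_def by blast
    hence "\<forall>z\<in>underS \<alpha> e. g z \<noteq> x \<and> (g z, x) \<in> ?s"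
      by blast
    hence "\<exists>x. x \<in> S e \<and> (\<forall>z\<in>underS \<alpha> e. g z \<noteq> x \<and> (g z, x) \<in> ?s)"
      using x(1) by blast
    thus ?case
      unfolding g_rec[of e] H_def by (rule someI_ex)
  qed
  let ?A = "g ` Field \<alpha>"
  have AF: "?A \<subseteq> Field ?s"
    using g S by blast
  have woA: "well_order_on ?A (Restr ?s ?A)"
    by (rule well_order_on_Restr[OF ws AF])
  hence FA: "Field (Restr ?s ?A) = ?A" and woA': "Well_order (Restr ?s ?A)"
    using well_order_on_Well_order[OF woA] by auto
  have total: "a = b \<or> a \<in> underS \<alpha> b \<or> b \<in> underS \<alpha> a"
    if "a \<in> Field \<alpha>" "b \<in> Field \<alpha>" for a b
    using wo_rel.TOTAL[OF wr] that unfolding total_on_def underS_def by auto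
  have "inj_on g (Field \<alpha>)"
  proof (rule inj_onI)
    fix a b
    assume ab: "a \<in> Field \<alpha>" "b \<in> Field \<alpha>" "g a = g b"
    show "a = b"
      using total[OF ab(1,2)] g[OF ab(1)] g[OF ab(2)] ab(3) by auto
  qed
  hence "bij_betw g (Field \<alpha>) (Field (Restr ?s ?A))"
    unfolding FA bij_betw_def by blast
  moreover have "compat \<alpha> (Restr ?s ?A) g"
    unfolding compat_def
  proof (intro allI impI)
    fix a b assume ab: "(a, b) \<in> \<alpha>"
    hence F: "a \<in> Field \<alpha>" "b \<in> Field \<alpha>"
      unfolding Field_def by blast+
    have "(g a, g b) \<in> ?s"
    proof (cases "a = b")
      case True
      have "refl_on (Field ?s) ?s"
        using ws unfolding order_on_defs by blast
      moreover have "g b \<in> Field ?s"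
        using F(2) AF by blast
      ultimately show ?thesis
        using True unfolding refl_on_def by blast
    next
      case False
      hence "a \<in> underS \<alpha> b"
        using ab unfolding underS_def by blast
      thus ?thesis
        using g[OF F(2)] by blast
    qed
    thus "(g a, g b) \<in> Restr ?s ?A"
      using F by blast
  qed
  ultimately have "iso \<alpha> (Restr ?s ?A) g"
    using iso_iff3[OF \<alpha>(1) woA'] by blast
  hence "\<alpha> =o Restr ?s ?A"
    using \<alpha>(1) woA' unfolding ordIso_def by blast
  thus ?thesis
    using g ordIso_symmetric by blast
qed

section \<open>Measurable cardinals\<close>

lemma complete_INT:
  assumes "complete_family r U" and "I \<noteq> {}" and "|I| <o r" and "\<And>i. i \<in> I \<Longrightarrow> A i \<in> U"
  shows "(\<Inter>i\<in>I. A i) \<in> U"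
proof -
  have "|A ` I| <o r"
    by (rule ordLeq_ordLess_trans[OF card_of_image assms(3)])
  moreover have "A ` I \<subseteq> U" "A ` I \<noteq> {}"
    using assms(2,4) by auto
  ultimately show ?thesis
    using assms(1) unfolding complete_family_def by simp
qed

text \<open>
  Unlike the intersection of an indexed family, this form covers the empty index set, whose
  intersection would be the universe of the type and not \<open>X\<close>.
\<close>
lemma complete_Ball:
  assumes U: "nonprincipal_ultrafilter_on X U" "complete_family r U" and I: "|I| <o r"
    and P: "\<And>i. i \<in> I \<Longrightarrow> {x\<in>X. P i x} \<in> U"
  shows "{x\<in>X. \<forall>i\<in>I. P i x} \<in> U"
proof (cases "I = {}")
  case True
  moreover have "X \<in> U"
    using U(1) unfolding nonprincipal_ultrafilter_on_def by auto
  ultimately show ?thesis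
    by simp
next
  case False
  have "(\<Inter>i\<in>I. {x\<in>X. P i x}) \<in> U"
    by (rule complete_INT[OF U(2) False I P])
  moreover have "(\<Inter>i\<in>I. {x\<in>X. P i x}) = {x\<in>X. \<forall>i\<in>I. P i x}"
    using False by auto
  ultimately show ?thesis
    by simp
qed

lemma ex_large_fibre:
  assumes U: "nonprincipal_ultrafilter_on X U" "complete_family r U"
    and T: "|T| <o r" and f: "\<And>x. x \<in> X \<Longrightarrow> f x \<in> T"
  shows "\<exists>c\<in>T. {x\<in>X. f x = c} \<in> U"
proof (rule ccontr)
  assume neg: "\<not> ?thesis"
  have XU: "X \<in> U" and ne: "{} \<notin> U"
    and ultra: "\<And>A. A \<subseteq> X \<Longrightarrow> A \<in> U \<or> X - A \<in> U"
    using U(1) unfolding nonprincipal_ultrafilter_on_def by auto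
  have "X \<noteq> {}"
    using XU ne by auto
  hence "T \<noteq> {}"
    using f by auto
  moreover have "X - {x\<in>X. f x = c} \<in> U" if "c \<in> T" for c
    using neg that ultra[of "{x\<in>X. f x = c}"] by auto
  ultimately have "(\<Inter>c\<in>T. X - {x\<in>X. f x = c}) \<in> U"
    by (intro complete_INT[OF U(2) _ T])
  moreover have "(\<Inter>c\<in>T. X - {x\<in>X. f x = c}) = {}"
    using f \<open>T \<noteq> {}\<close> by blast
  ultimately show False
    using ne by simp
qed

lemma card_of_ultrafilter_member:
  assumes r: "Card_order r"
    and U: "nonprincipal_ultrafilter_on (Field r) U" "complete_family r U" and A: "A \<in> U"
  shows "|A| =o r"
proof -
  have AF: "A \<subseteq> Field r" and "{} \<notin> U"
    and single: "\<And>x. x \<in> Field r \<Longrightarrow> {x} \<notin> U"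
    and inter: "\<And>A B. A \<in> U \<Longrightarrow> B \<in> U \<Longrightarrow> A \<inter> B \<in> U"
    and ultra: "\<And>A. A \<subseteq> Field r \<Longrightarrow> A \<in> U \<or> Field r - A \<in> U"
    using U(1) A unfolding nonprincipal_ultrafilter_on_def by auto
  have "\<not> |A| <o r"
  proof
    assume small: "|A| <o r"
    have "A \<noteq> {}"
      using A \<open>{} \<notin> U\<close> by blast
    moreover have "Field r - {x} \<in> U" if "x \<in> A" for x
      using that AF single[of x] ultra[of "{x}"] by blast
    ultimately have "(\<Inter>x\<in>A. Field r - {x}) \<in> U"
      by (intro complete_INT[OF U(2) _ small])
    hence "A \<inter> (\<Inter>x\<in>A. Field r - {x}) \<in> U"
      by (rule inter[OF A])
    moreover have "A \<inter> (\<Inter>x\<in>A. Field r - {x}) = {}"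
      by blast
    ultimately have "{} \<in> U"
      by simp
    thus False
      using \<open>{} \<notin> U\<close> by blast
  qed
  moreover have "|A| \<le>o r"
    using card_of_mono1[OF AF] card_of_Field_ordIso[OF r] ordLeq_ordIso_trans by blast
  ultimately show ?thesis
    using ordLeq_iff_ordLess_or_ordIso by blast
qed

text \<open>
  Measurable cardinals are strong limits. Suppose that \<open>F\<close> injects \<open>r\<close> into the power set of \<open>X\<close>.
  For each \<open>\<xi> \<in> X\<close>, the truth value of \<open>\<xi> \<in> F x\<close> is constant for \<open>x\<close> in some member of the
  ultrafilter. On the intersection of these members \<open>F\<close> is constant, so the intersection has at most
  one point, which contradicts nonprincipality.
\<close>
lemma measurable_cardinal_Pow:
  assumes m: "measurable_cardinal r" and X: "|X| <o r"
  shows "|Pow X| <o r"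
proof (rule ccontr)
  assume "\<not> |Pow X| <o r"
  obtain U where r: "Card_order r" "natLeq <o r"
    and U: "nonprincipal_ultrafilter_on (Field r) U" "complete_family r U"
    using m unfolding measurable_cardinal_def by blast
  have wo: "Well_order r"
    using r(1) unfolding card_order_on_def by blast
  have "r \<le>o |Pow X|"
    using \<open>\<not> |Pow X| <o r\<close> not_ordLeq_iff_ordLess[OF card_of_Well_order wo]
    by blast
  hence "|Field r| \<le>o |Pow X|"
    using card_of_Field_ordIso[OF r(1)] ordIso_ordLeq_trans by blast
  then obtain F where F: "inj_on F (Field r)" "F ` Field r \<subseteq> Pow X"
    unfolding card_of_ordLeq[symmetric] by blast
  have Field_U: "Field r \<in> U" and "{} \<notin> U" and U_sub: "U \<subseteq> Pow (Field r)"
    and single: "\<And>x. x \<in> Field r \<Longrightarrow> {x} \<notin> U"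
    using U(1) unfolding nonprincipal_ultrafilter_on_def by auto
  have not_small: "\<not> (\<forall>x\<in>A. \<forall>y\<in>A. x = y)" if "A \<in> U" for A
  proof
    assume eq: "\<forall>x\<in>A. \<forall>y\<in>A. x = y"
    obtain x where x: "x \<in> A"
      using \<open>A \<in> U\<close> \<open>{} \<notin> U\<close> by fastforce
    hence "A = {x}"
      using eq by blast
    thus False
      using x single U_sub \<open>A \<in> U\<close> by blast
  qed
  have "X \<noteq> {}"
  proof
    assume "X = {}"
    hence "F x = {}" if "x \<in> Field r" for x
      using F(2) that by blast
    hence "\<forall>x\<in>Field r. \<forall>y\<in>Field r. x = y"
      using F(1) unfolding inj_on_def by simp
    thus False
      using not_small[OF Field_U] by blast
  qed
  have two: "|UNIV :: bool set| <o r"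
  proof -
    have "|UNIV :: bool set| <o natLeq"
      using finite_ordLess_infinite[OF card_of_Well_order natLeq_Well_order, of "UNIV :: bool set"]
      by (simp add: Field_natLeq Field_card_of)
    thus ?thesis using r(2) ordLess_transitive by blast
  qed
  define c where "c \<xi> = (SOME c. {x\<in>Field r. (\<xi> \<in> F x) = c} \<in> U)" for \<xi>
  have c: "{x\<in>Field r. (\<xi> \<in> F x) = c \<xi>} \<in> U" for \<xi>
  proof -
    have "\<exists>c\<in>UNIV. {x\<in>Field r. (\<xi> \<in> F x) = c} \<in> U"
      by (rule ex_large_fibre[OF U two]) simp
    hence "\<exists>c. {x\<in>Field r. (\<xi> \<in> F x) = c} \<in> U"
      by simp
    thus ?thesis
      unfolding c_def by (rule someI_ex)
  qed
  let ?A = "\<Inter>\<xi>\<in>X. {x\<in>Field r. (\<xi> \<in> F x) = c \<xi>}"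
  have A: "?A \<in> U"
    using c by (intro complete_INT[OF U(2) \<open>X \<noteq> {}\<close> X])
  have "x = y" if "x \<in> ?A" "y \<in> ?A" for x y
  proof -
    have xy: "x \<in> Field r" "y \<in> Field r"
      using that \<open>X \<noteq> {}\<close> by blast+
    have "\<xi> \<in> F x \<longleftrightarrow> \<xi> \<in> F y" if "\<xi> \<in> X" for \<xi>
      using that \<open>x \<in> ?A\<close> \<open>y \<in> ?A\<close> by simp
    moreover have "F x \<subseteq> X" "F y \<subseteq> X"
      using F(2) xy by blast+
    ultimately have "F x = F y"
      by blast
    thus ?thesis
      using F(1) xy by (simp add: inj_on_def)
  qed
  thus False
    using not_small[OF A] by blast
qed

section \<open>Limits of measurable cardinals\<close>

text \<open>
  The definition of a limit of measurable cardinals speaks of relations on the type of \<open>\<mu>\<close> only. Here the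
  smaller cardinal may live on any type.
\<close>
lemma limit_of_measurables_above_card:
  fixes \<mu> :: "'a rel" and X :: "'x set"
  assumes "Card_order \<mu>" and "limit_of_measurables \<mu>" and "|X| <o \<mu>"
  obtains k :: "'a rel" where "measurable_cardinal k" and "|X| <o k" and "k <o \<mu>"
proof -
  obtain a where a: "a \<in> Field \<mu>" "|X| =o |underS \<mu> a|"
    using ordLess_card_of_underS[OF assms(1,3)] by blast
  obtain k :: "'a rel" where "measurable_cardinal k" "|underS \<mu> a| <o k" "k <o \<mu>"
    using assms(2) card_of_underS[OF assms(1) a(1)] unfolding limit_of_measurables_def by blast
  thus thesis
    using that a(2) ordIso_ordLess_trans by blast
qed

lemma limit_of_measurables_Pow:
  fixes \<mu> :: "'a rel"
  assumes "Card_order \<mu>" and "limit_of_measurables \<mu>" and "|X| <o \<mu>"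
  shows "|Pow X| <o \<mu>"
proof -
  obtain k :: "'a rel" where "measurable_cardinal k" "|X| <o k" "k <o \<mu>"
    using limit_of_measurables_above_card[OF assms] .
  thus ?thesis
    using measurable_cardinal_Pow ordLess_transitive by blast
qed

lemma card_of_Times_ordLess_infinite_Field:
  assumes r: "Card_order r" "infinite (Field r)" and A: "|A| <o r" and B: "|B| <o r"
  shows "|A \<times> B| <o r"
proof (cases "finite A \<and> finite B")
  case True
  have "Well_order r"
    using r(1) unfolding card_order_on_def by blast
  thus ?thesis
    using finite_ordLess_infinite[OF card_of_Well_order, of r "A \<times> B"] True r(2)
    by (simp add: Field_card_of)
next
  case False
  hence "infinite (A <+> B)"
    by auto
  hence "|A \<times> B| \<le>o |A <+> B|"
    using card_of_Times_ordLeq_infinite_Field[of "|A <+> B|" A B]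
      card_of_Plus1 card_of_Plus2 card_of_Card_order by (metis Field_card_of)
  thus ?thesis
    using card_of_Plus_ordLess_infinite_Field[OF r(2,1) A B] ordLeq_ordLess_trans by blast
qed

section \<open>Cofinality\<close>

lemma cofinality_witness:
  assumes "Card_order \<mu>" and "infinite (Field \<mu>)"
  obtains K where "K \<subseteq> Field \<mu>" and "cofinal K \<mu>" and "cofinality \<mu> = |K|"
    and "\<And>L. L \<subseteq> Field \<mu> \<Longrightarrow> cofinal L \<mu> \<Longrightarrow> |K| \<le>o |L|"
proof -
  let ?P = "\<lambda>K. K \<subseteq> Field \<mu> \<and> cofinal K \<mu> \<and>
     (\<forall>L. L \<subseteq> Field \<mu> \<and> cofinal L \<mu> \<longrightarrow> |K| \<le>o |L| )"
  let ?R = "{ |K| | K. K \<subseteq> Field \<mu> \<and> cofinal K \<mu>}"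
  have "cofinal (Field \<mu>) \<mu>"
    using infinite_Card_order_limit[OF assms] unfolding cofinal_def by blast
  hence "?R \<noteq> {}"
    by blast
  moreover have "\<forall>s\<in>?R. Card_order s"
    using card_of_Card_order by blast
  ultimately obtain s where "s \<in> ?R" "\<forall>s'\<in>?R. s \<le>o s'"
    using exists_minim_Card_order by meson
  hence "\<exists>K. ?P K"
    by blast
  hence "?P (SOME K. ?P K)"
    by (rule someI_ex)
  thus thesis
    using that unfolding cofinality_def by blast
qed

lemma cofinal_infinite:
  assumes \<mu>: "Card_order \<mu>" "infinite (Field \<mu>)" and K: "K \<subseteq> Field \<mu>" "cofinal K \<mu>"
  shows "infinite K"
proof
  assume fin: "finite K"
  have un: "Field \<mu> \<subseteq> (\<Union>k\<in>K. under \<mu> k)"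
    using K(2) unfolding cofinal_def under_def by blast
  \<comment> \<open>A finite set has a maximal element, which contradicts cofinality.\<close>
  have "wf ((\<mu> - Id)\<inverse> \<inter> K \<times> K)"
  proof (rule finite_acyclic_wf)
    show "finite ((\<mu> - Id)\<inverse> \<inter> K \<times> K)"
      using fin by simp
    have "acyclic (\<mu> - Id)"
      using \<mu>(1) unfolding card_order_on_def order_on_defs by (blast intro: wf_acyclic)
    thus "acyclic ((\<mu> - Id)\<inverse> \<inter> K \<times> K)"
      using acyclic_converse acyclic_subset by (metis Int_lower1)
  qed
  moreover have "K \<noteq> {}"
    using un \<mu>(2) by force
  ultimately obtain k where k: "k \<in> K" "\<And>y. (y, k) \<in> (\<mu> - Id)\<inverse> \<inter> K \<times> K \<Longrightarrow> y \<notin> K"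
    by (metis wf_eq_minimal ex_in_conv)
  moreover obtain b where "b \<in> K" "k \<noteq> b" "(k, b) \<in> \<mu>"
    using K k(1) unfolding cofinal_def by blast
  ultimately show False
    by blast
qed

text \<open>
  A union of fewer than \<open>cf \<mu>\<close> sets, all of cardinality below \<open>\<mu>\<close>, has cardinality below \<open>\<mu>\<close>: the
  cardinalities of the sets are bounded below \<open>\<mu>\<close>. Here \<open>K\<close> is a cofinal set of least cardinality.
\<close>
lemma ex_member_of_full_card:
  assumes \<mu>: "Card_order \<mu>" "infinite (Field \<mu>)"
    and K: "K \<subseteq> Field \<mu>" "cofinal K \<mu>"
      "\<And>L. L \<subseteq> Field \<mu> \<Longrightarrow> cofinal L \<mu> \<Longrightarrow> |K| \<le>o |L|" "|K| <o \<mu>"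
    and T: "|T| <o |K|" and D: "\<And>c. c \<in> T \<Longrightarrow> D c \<subseteq> Field \<mu>"
    and full: "|\<Union>c\<in>T. D c| =o \<mu>"
  shows "\<exists>c\<in>T. |D c| =o \<mu>"
proof (rule ccontr)
  assume neg: "\<not> ?thesis"
  have small: "|D c| <o \<mu>" if "c \<in> T" for c
  proof -
    have "|D c| \<le>o \<mu>"
      using card_of_mono1[OF D[OF that]] card_of_Field_ordIso[OF \<mu>(1)] ordLeq_ordIso_trans by blast
    thus ?thesis
      using neg that ordLeq_iff_ordLess_or_ordIso by blast
  qed
  have "\<forall>c\<in>T. \<exists>a. a \<in> Field \<mu> \<and> |D c| =o |underS \<mu> a|"
    using ordLess_card_of_underS[OF \<mu>(1) small] by blast
  then obtain q where q: "\<forall>c\<in>T. q c \<in> Field \<mu> \<and> |D c| =o |underS \<mu> (q c)|"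
    by (rule bchoice[THEN exE])
  have "\<not> cofinal (q ` T) \<mu>"
  proof
    assume "cofinal (q ` T) \<mu>"
    hence "|K| \<le>o |q ` T|"
      using q by (intro K(3)) auto
    also have "|q ` T| \<le>o |T|"
      by (rule card_of_image)
    also note T
    finally show False
      using ordLess_irreflexive by blast
  qed
  then obtain a where a: "a \<in> Field \<mu>" "\<And>c. c \<in> T \<Longrightarrow> a = q c \<or> (a, q c) \<notin> \<mu>"
    unfolding cofinal_def by blast
  have wo: "wo_rel \<mu>"
    using \<mu>(1) unfolding card_order_on_def wo_rel_def by blast
  let ?Z = "K \<union> under \<mu> a"
  have Z: "|?Z| <o \<mu>"
    by (rule card_of_Un_ordLess_infinite_Field[OF \<mu>(2,1) K(4) card_of_under[OF \<mu> a(1)]])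
  have "|D c| \<le>o |?Z|" if c: "c \<in> T" for c
  proof -
    have "(q c, a) \<in> \<mu>"
      using a c q wo_rel.TOTALS[OF wo] wo_rel.REFL[OF wo] unfolding refl_on_def by metis
    moreover have "trans \<mu>"
      by (rule wo_rel.TRANS[OF wo])
    ultimately have "underS \<mu> (q c) \<subseteq> ?Z"
      unfolding underS_def under_def trans_def by blast
    from card_of_mono1[OF this] show ?thesis
      using q c ordIso_ordLeq_trans by blast
  qed
  moreover have "infinite ?Z"
    using cofinal_infinite[OF \<mu> K(1,2)] by simp
  moreover have "|T| \<le>o |?Z|"
    by (rule ordLeq_transitive[OF ordLess_imp_ordLeq[OF T] card_of_mono1]) simp
  ultimately have "|\<Union>c\<in>T. D c| \<le>o |?Z|"
    by (intro card_of_UNION_ordLeq_infinite) auto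
  hence "|\<Union>c\<in>T. D c| <o \<mu>"
    using Z ordLeq_ordLess_trans by blast
  thus False
    using full not_ordLess_ordIso by blast
qed

section \<open>Simultaneous homogeneity\<close>

lemma graph_image_eqD:
  assumes "(\<lambda>y. (y, f y)) ` Y = (\<lambda>y. (y, g y)) ` Y" and "y \<in> Y"
  shows "f y = g y"
proof -
  have "(y, f y) \<in> (\<lambda>y. (y, g y)) ` Y"
    using assms by blast
  thus ?thesis by auto
qed

text \<open>
  Each \<open>code j\<close> splits \<open>\<mu>\<^sup>+\<close> into at most \<open>\<mu>\<close> classes. The classes of cardinality at most \<open>\<mu>\<close>, taken over
  all \<open>j\<close>, cover only \<open>\<mu>\<close> many points, so some point lies in none of them.
\<close>
lemma ex_point_with_large_classes:
  assumes \<mu>: "Card_order \<mu>" "infinite (Field \<mu>)"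
    and K: "|K| \<le>o \<mu>" and V: "\<And>j. j \<in> K \<Longrightarrow> |code j ` Field (cardSuc \<mu>)| \<le>o \<mu>"
  shows "\<exists>a\<in>Field (cardSuc \<mu>). \<forall>j\<in>K. \<not> |{b\<in>Field (cardSuc \<mu>). code j b = code j a}| \<le>o \<mu>"
proof (rule ccontr)
  let ?F = "Field (cardSuc \<mu>)"
  assume neg: "\<not> ?thesis"
  let ?Z = "{z \<in> (SIGMA j:K. code j ` ?F). |{b\<in>?F. code (fst z) b = snd z}| \<le>o \<mu>}"
  have "|?Z| \<le>o |SIGMA j:K. code j ` ?F|"
    by (rule card_of_mono1) blast
  also have "|SIGMA j:K. code j ` ?F| \<le>o \<mu>"
    using V by (intro card_of_Sigma_ordLeq_infinite_Field[OF \<mu>(2,1) K]) simp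
  finally have "|?Z| \<le>o \<mu>" .
  hence "|\<Union>z\<in>?Z. {b\<in>?F. code (fst z) b = snd z}| \<le>o \<mu>"
    by (rule card_of_UNION_ordLeq_infinite_Field[OF \<mu>(2,1)]) simp
  moreover have "?F \<subseteq> (\<Union>z\<in>?Z. {b\<in>?F. code (fst z) b = snd z})"
  proof
    fix b
    assume b: "b \<in> ?F"
    then obtain j where "j \<in> K" "|{b'\<in>?F. code j b' = code j b}| \<le>o \<mu>"
      using neg by blast
    hence "(j, code j b) \<in> ?Z"
      using b by simp
    moreover have "b \<in> {b'\<in>?F. code (fst (j, code j b)) b' = snd (j, code j b)}"
      using b by simp
    ultimately show "b \<in> (\<Union>z\<in>?Z. {b\<in>?F. code (fst z) b = snd z})"
      by (rule UN_I)
  qed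
  ultimately have "|?F| \<le>o \<mu>"
    using card_of_mono1 ordLeq_transitive by blast
  moreover have "\<mu> <o |?F|"
    using cardSuc_greater[OF \<mu>(1)] card_of_Field_ordIso[OF cardSuc_Card_order[OF \<mu>(1)]]
      ordLess_ordIso_trans ordIso_symmetric by blast
  ultimately show False
    using not_ordLess_ordLeq by blast
qed

text \<open>
  No relation between the colours on \<open>B i\<close> for different \<open>i\<close> is claimed, and
  the sets \<open>B i\<close> need not be disjoint. The set \<open>K\<close> need not have order type \<open>cf \<mu>\<close>, so the sets are compared
  through the cardinality of \<open>underS \<mu> i\<close> and not through the position of \<open>i\<close> in \<open>K\<close>.
\<close>
lemma simultaneous_homogeneous_sets:
  fixes \<mu> :: "'a rel" and T :: "'b set" and d :: "'a set \<times> 'a \<Rightarrow> 'b"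
  assumes \<mu>: "Card_order \<mu>" "infinite (Field \<mu>)" "limit_of_measurables \<mu>"
    and K: "K \<subseteq> Field \<mu>" "cofinal K \<mu>" "|K| <o \<mu>" and T: "|T| <o \<mu>"
    and \<alpha>: "Well_order \<alpha>" "\<alpha> <o cardSuc \<mu>"
    and d: "d \<in> Field (cardSuc \<mu>) \<times> Field \<mu> \<rightarrow> T"
  obtains A B where "A \<subseteq> Field (cardSuc \<mu>)" and "Restr (cardSuc \<mu>) A =o \<alpha>"
    and "\<And>i. i \<in> K \<Longrightarrow> B i \<subseteq> Field \<mu>"
    and "\<And>i. i \<in> K \<Longrightarrow> |underS \<mu> i| <o |B i|"
    and "\<And>i. i \<in> K \<Longrightarrow> const_on d (A \<times> B i)"
proof -
  let ?s = "cardSuc \<mu>"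
  have F\<mu>: "|Field \<mu>| =o \<mu>"
    by (rule card_of_Field_ordIso[OF \<mu>(1)])
  have "\<exists>k :: 'a rel. measurable_cardinal k \<and> |underS \<mu> i| <o k \<and> |K| <o k \<and> |T| <o k \<and> k <o \<mu>"
    if i: "i \<in> K" for i
  proof -
    have "|underS \<mu> i| <o \<mu>"
      using card_of_underS[OF \<mu>(1)] i K(1) by blast
    hence "|underS \<mu> i <+> K <+> T| <o \<mu>"
      by (intro card_of_Plus_ordLess_infinite_Field[OF \<mu>(2,1)] K(3) T)
    then obtain k :: "'a rel"
      where k: "measurable_cardinal k" "|underS \<mu> i <+> K <+> T| <o k" "k <o \<mu>"
      using limit_of_measurables_above_card[OF \<mu>(1,3)] by blast
    have "|underS \<mu> i| <o k"
      by (rule ordLeq_ordLess_trans[OF card_of_Plus1 k(2)])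
    moreover have "|K <+> T| <o k"
      by (rule ordLeq_ordLess_trans[OF card_of_Plus2 k(2)])
    ultimately show ?thesis
      using k(1,3) ordLeq_ordLess_trans[OF card_of_Plus1] ordLeq_ordLess_trans[OF card_of_Plus2]
      by blast
  qed
  hence "\<forall>i\<in>K. \<exists>k :: 'a rel.
      measurable_cardinal k \<and> |underS \<mu> i| <o k \<and> |K| <o k \<and> |T| <o k \<and> k <o \<mu>"
    by blast
  then obtain M :: "'a \<Rightarrow> 'a rel" where M: "\<forall>i\<in>K. measurable_cardinal (M i) \<and>
      |underS \<mu> i| <o M i \<and> |K| <o M i \<and> |T| <o M i \<and> M i <o \<mu>"
    by (rule bchoice[THEN exE])
  have cM: "Card_order (M i)" if "i \<in> K" for i
    using M that unfolding measurable_cardinal_def by blast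
  have "\<forall>i\<in>K. \<exists>U. nonprincipal_ultrafilter_on (Field (M i)) U \<and> complete_family (M i) U"
    using M unfolding measurable_cardinal_def by blast
  then obtain U where U: "\<forall>i\<in>K. nonprincipal_ultrafilter_on (Field (M i)) (U i) \<and>
      complete_family (M i) (U i)"
    by (rule bchoice[THEN exE])
  have "\<forall>i\<in>K. \<exists>h. inj_on h (Field (M i)) \<and> h ` Field (M i) \<subseteq> Field \<mu>"
  proof
    fix i
    assume "i \<in> K"
    hence "|Field (M i)| \<le>o |Field \<mu>|"
      using M ordLess_imp_ordLeq by (intro card_of_mono2) blast
    thus "\<exists>h. inj_on h (Field (M i)) \<and> h ` Field (M i) \<subseteq> Field \<mu>"
      unfolding card_of_ordLeq .
  qed
  then obtain h where h: "\<forall>i\<in>K. inj_on (h i) (Field (M i)) \<and> h i ` Field (M i) \<subseteq> Field \<mu>"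
    by (rule bchoice[THEN exE])
  \<comment> \<open>The colour that \<open>b\<close> assumes on a set in \<open>U i\<close>.\<close>
  define c where "c b i = (SOME t. t \<in> T \<and> {x\<in>Field (M i). d (b, h i x) = t} \<in> U i)" for b i
  have c: "c b i \<in> T \<and> {x\<in>Field (M i). d (b, h i x) = c b i} \<in> U i"
    if b: "b \<in> Field ?s" and i: "i \<in> K" for b i
  proof -
    have "\<exists>t\<in>T. {x\<in>Field (M i). d (b, h i x) = t} \<in> U i"
    proof (rule ex_large_fibre)
      show "nonprincipal_ultrafilter_on (Field (M i)) (U i)" "complete_family (M i) (U i)"
        "|T| <o M i"
        using U M i by blast+
      show "d (b, h i x) \<in> T" if "x \<in> Field (M i)" for x
        using d h i b that by (auto intro!: funcset_mem[OF d])
    qed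
    thus ?thesis
      unfolding c_def Bex_def by (rule someI_ex)
  qed
  \<comment> \<open>The part of \<open>\<mu>\<close> on which the colouring by \<open>b\<close> is recorded in \<open>code j b\<close>.\<close>
  define Y where "Y j = (\<Union>i\<in>{i\<in>K. M i \<le>o |underS \<mu> j|}. h i ` Field (M i))" for j
  have Y_Field: "Y j \<subseteq> Field \<mu>" for j
    using h unfolding Y_def by blast
  have Y_small: "|Y j| <o \<mu>" if j: "j \<in> K" for j
  proof -
    let ?Z = "K \<union> underS \<mu> j"
    have "|Y j| \<le>o |?Z|"
      unfolding Y_def
    proof (intro card_of_UNION_ordLeq_infinite ballI)
      show "infinite ?Z"
        using cofinal_infinite[OF \<mu>(1,2) K(1,2)] by simp
      show "|{i\<in>K. M i \<le>o |underS \<mu> j|}| \<le>o |?Z|"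
        by (rule card_of_mono1) blast
      fix i
      assume i: "i \<in> {i\<in>K. M i \<le>o |underS \<mu> j|}"
      have "|h i ` Field (M i)| \<le>o |Field (M i)|"
        by (rule card_of_image)
      also have "|Field (M i)| =o M i"
        using i by (intro card_of_Field_ordIso cM) simp
      also have "M i \<le>o |underS \<mu> j|"
        using i by simp
      also have "|underS \<mu> j| \<le>o |?Z|"
        by (rule card_of_mono1) simp
      finally show "|h i ` Field (M i)| \<le>o |?Z|" .
    qed
    moreover have "|?Z| <o \<mu>"
      using card_of_underS[OF \<mu>(1)] j K(1)
      by (intro card_of_Un_ordLess_infinite_Field[OF \<mu>(2,1) K(3)]) blast
    ultimately show ?thesis
      using ordLeq_ordLess_trans by blast
  qed
  \<comment> \<open>Both components are graphs of functions, so that sets of pairs bound the number of codes.\<close>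
  define code where
    "code j b = ((\<lambda>i. (i, c b i)) ` K, (\<lambda>y. (y, d (b, y))) ` Y j)" for j b
  have "|code j ` Field ?s| \<le>o \<mu>" if j: "j \<in> K" for j
  proof -
    have sub: "code j ` Field ?s \<subseteq> Pow (K \<times> T) \<times> Pow (Y j \<times> T)"
    proof
      fix v
      assume "v \<in> code j ` Field ?s"
      then obtain b where b: "b \<in> Field ?s" "v = code j b"
        by blast
      have "d (b, y) \<in> T" if "y \<in> Y j" for y
        using b(1) that Y_Field by (intro funcset_mem[OF d]) blast
      thus "v \<in> Pow (K \<times> T) \<times> Pow (Y j \<times> T)"
        using c[OF b(1)] unfolding b(2) code_def by auto
    qed
    have "|Pow (K \<times> T) \<times> Pow (Y j \<times> T)| <o \<mu>"
      by (intro card_of_Times_ordLess_infinite_Field[OF \<mu>(1,2)] limit_of_measurables_Pow[OF \<mu>(1,3)] K(3) T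
          Y_small[OF j])
    thus ?thesis
      using card_of_mono1[OF sub] ordLeq_ordLess_trans ordLess_imp_ordLeq by blast
  qed
  then obtain a where a: "a \<in> Field ?s"
    and large: "\<And>j. j \<in> K \<Longrightarrow> \<not> |{b\<in>Field ?s. code j b = code j a}| \<le>o \<mu>"
    using ex_point_with_large_classes[OF \<mu>(1,2) ordLess_imp_ordLeq[OF K(3)], of code] by blast
  have code_c: "c b i = c a i" if "code j b = code j a" "i \<in> K" for b i j
    using that(1) unfolding code_def prod.inject
    by (elim conjE) (rule graph_image_eqD[OF _ that(2), of "c b" "c a"])
  have code_d: "d (b, y) = d (a, y)" if "code j b = code j a" "y \<in> Y j" for b y j
    using that(1) unfolding code_def prod.inject
    by (elim conjE) (rule graph_image_eqD[OF _ that(2), of "\<lambda>y. d (b, y)" "\<lambda>y. d (a, y)"])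
  have "|Field \<alpha>| \<le>o \<mu>"
    using ordLess_Field[OF \<alpha>(2)] cardSuc_ordLeq_ordLess[OF \<mu>(1) card_of_Card_order] by blast
  hence "|Field \<alpha>| \<le>o |Field \<mu>|"
    using F\<mu> ordLeq_ordIso_trans ordIso_symmetric by blast
  then obtain f where f: "inj_on f (Field \<alpha>)" "f ` Field \<alpha> \<subseteq> Field \<mu>"
    unfolding card_of_ordLeq[symmetric] by blast
  \<comment> \<open>As \<open>f\<close> is injective, the points \<open>e\<close> with \<open>J e = j\<close> are no more than the points of \<open>underS \<mu> j\<close>.\<close>
  have "\<forall>e\<in>Field \<alpha>. \<exists>j. j \<in> K \<and> f e \<in> underS \<mu> j"
    using f(2) K(2) unfolding cofinal_def underS_def by blast
  then obtain J where J: "\<forall>e\<in>Field \<alpha>. J e \<in> K \<and> f e \<in> underS \<mu> (J e)"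
    by (rule bchoice[THEN exE])
  define S where "S e = {b\<in>Field ?s. code (J e) b = code (J e) a}" for e
  have "S e \<subseteq> Field ?s \<and> \<not> |S e| \<le>o \<mu>" if "e \<in> Field \<alpha>" for e
    using large J that unfolding S_def by blast
  then obtain g where g: "\<forall>e\<in>Field \<alpha>. g e \<in> S e"
    and otp: "Restr ?s (g ` Field \<alpha>) =o \<alpha>"
    using ex_increasing_selection[OF \<mu>(1,2) \<alpha>, of S] by blast
  have gF: "g e \<in> Field ?s" and g_code: "code (J e) (g e) = code (J e) a" if "e \<in> Field \<alpha>" for e
    using g that unfolding S_def by blast+
  define W where "W i = {x\<in>Field (M i). \<forall>e\<in>Field \<alpha>. d (g e, h i x) = c a i}" for i
  have W: "W i \<in> U i" if i: "i \<in> K" for i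
  proof -
    have Ui: "nonprincipal_ultrafilter_on (Field (M i)) (U i)" "complete_family (M i) (U i)"
      using U i by blast+
    \<comment> \<open>These are the \<open>j\<close> for which \<open>M i\<close> is too large for the colouring on it to be part of \<open>code j\<close>.\<close>
    let ?N = "{j\<in>K. |underS \<mu> j| <o M i}"
    let ?E = "\<lambda>j. {e\<in>Field \<alpha>. J e = j}"
    let ?W1 = "{x\<in>Field (M i). d (a, h i x) = c a i}"
    let ?W2 = "{x\<in>Field (M i). \<forall>j\<in>?N. \<forall>e\<in>?E j. d (g e, h i x) = c a i}"
    have "?W1 \<in> U i"
      using c[OF a i] by blast
    moreover have "?W2 \<in> U i"
    proof (rule complete_Ball[OF Ui])
      have "|?N| \<le>o |K|"
        by (rule card_of_mono1) blast
      thus "|?N| <o M i"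
        using M i ordLeq_ordLess_trans by blast
      fix j
      assume j: "j \<in> ?N"
      show "{x\<in>Field (M i). \<forall>e\<in>?E j. d (g e, h i x) = c a i} \<in> U i"
      proof (rule complete_Ball[OF Ui])
        have "|?E j| \<le>o |underS \<mu> j|"
          using f(1) J by (intro card_of_ordLeqI[of f]) (auto simp: inj_on_def)
        thus "|?E j| <o M i"
          using j ordLeq_ordLess_trans by blast
        fix e
        assume e: "e \<in> ?E j"
        hence "c (g e) i = c a i"
          using code_c[OF g_code i] by blast
        thus "{x\<in>Field (M i). d (g e, h i x) = c a i} \<in> U i"
          using c[OF gF i, of e] e by simp
      qed
    qed
    ultimately have int: "?W1 \<inter> ?W2 \<in> U i"
      using Ui(1) unfolding nonprincipal_ultrafilter_on_def by simp
    have "?W1 \<inter> ?W2 \<subseteq> W i"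
    proof
      fix x
      assume x: "x \<in> ?W1 \<inter> ?W2"
      have "d (g e, h i x) = c a i" if e: "e \<in> Field \<alpha>" for e
      proof (cases "|underS \<mu> (J e)| <o M i")
        case True
        thus ?thesis
          using x e J by blast
      next
        case False
        hence "M i \<le>o |underS \<mu> (J e)|"
          using cM[OF i] not_ordLess_iff_ordLeq[OF card_of_Well_order]
            ordLess_or_ordLeq[OF card_of_Well_order] unfolding card_order_on_def by blast
        hence "h i x \<in> Y (J e)"
          using x i unfolding Y_def by blast
        thus ?thesis
          using code_d[OF g_code[OF e]] x by simp
      qed
      thus "x \<in> W i"
        using x unfolding W_def by simp
    qed
    moreover have "W i \<subseteq> Field (M i)"
      unfolding W_def by blast
    ultimately show ?thesis
      using Ui(1) int unfolding nonprincipal_ultrafilter_on_def by meson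
  qed
  show thesis
  proof (rule that)
    show "g ` Field \<alpha> \<subseteq> Field ?s"
      using gF by blast
    show "Restr ?s (g ` Field \<alpha>) =o \<alpha>"
      by (rule otp)
    fix i
    assume i: "i \<in> K"
    have WF: "W i \<subseteq> Field (M i)"
      unfolding W_def by blast
    show "h i ` W i \<subseteq> Field \<mu>"
      using h i WF by blast
    have "inj_on (h i) (W i)"
      using h i WF inj_on_subset by blast
    hence "|W i| =o |h i ` W i|"
      by (intro card_of_ordIsoI[of "h i"] inj_on_imp_bij_betw)
    moreover have "|W i| =o M i"
      using U i by (intro card_of_ultrafilter_member[OF cM[OF i] _ _ W[OF i]]) blast+
    ultimately have "M i =o |h i ` W i|"
      using ordIso_symmetric ordIso_transitive by blast
    thus "|underS \<mu> i| <o |h i ` W i|"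
      using M i ordLess_ordIso_trans by blast
    show "const_on d (g ` Field \<alpha> \<times> h i ` W i)"
      unfolding const_on_def W_def by (intro exI[of _ "c a i"]) auto
  qed
qed

section \<open>The partition relations\<close>

lemma card_of_UNION_cofinal:
  assumes \<mu>: "Card_order \<mu>" and K: "cofinal K \<mu>"
    and B: "\<And>i. i \<in> K \<Longrightarrow> B i \<subseteq> Field \<mu>" "\<And>i. i \<in> K \<Longrightarrow> |underS \<mu> i| <o |B i|"
  shows "|\<Union>i\<in>K. B i| =o \<mu>"
proof -
  have sub: "(\<Union>i\<in>K. B i) \<subseteq> Field \<mu>"
    using B(1) by blast
  have "|\<Union>i\<in>K. B i| \<le>o \<mu>"
    using card_of_mono1[OF sub] card_of_Field_ordIso[OF \<mu>] ordLeq_ordIso_trans by blast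
  moreover have "\<not> |\<Union>i\<in>K. B i| <o \<mu>"
  proof
    assume "|\<Union>i\<in>K. B i| <o \<mu>"
    then obtain a where a: "a \<in> Field \<mu>" "|\<Union>i\<in>K. B i| =o |underS \<mu> a|"
      using ordLess_card_of_underS[OF \<mu>] by blast
    obtain i where i: "i \<in> K" "a \<noteq> i" "(a, i) \<in> \<mu>"
      using K a(1) unfolding cofinal_def by blast
    have "trans \<mu>" "antisym \<mu>"
      using \<mu> unfolding card_order_on_def order_on_defs by blast+
    hence "underS \<mu> a \<subseteq> underS \<mu> i"
      using i unfolding underS_def trans_def antisym_def by blast
    hence "|underS \<mu> a| \<le>o |underS \<mu> i|"
      by (rule card_of_mono1)
    also have "|underS \<mu> i| <o |B i|"
      by (rule B(2)[OF i(1)])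
    also have "|B i| \<le>o |\<Union>i\<in>K. B i|"
      using i(1) by (intro card_of_mono1) blast
    also note a(2)
    finally show False
      using ordLess_irreflexive by blast
  qed
  ultimately show ?thesis
    using ordLeq_iff_ordLess_or_ordIso by blast
qed

lemma polarized_partition_below_cofinality:
  fixes \<mu> :: "'a rel" and \<theta> :: "'b rel" and \<alpha> :: "'c rel"
  assumes \<mu>: "singular_cardinal \<mu>" "limit_of_measurables \<mu>"
    and \<theta>: "\<theta> <o cofinality \<mu>" and \<alpha>: "Well_order \<alpha>" "\<alpha> <o cardSuc \<mu>"
  shows "polarized_partition (cardSuc \<mu>) \<mu> \<alpha> \<mu> \<theta>"
  unfolding polarized_partition_def
proof (intro allI impI)
  fix d :: "'a set \<times> 'a \<Rightarrow> 'b"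
  assume d: "d \<in> Field (cardSuc \<mu>) \<times> Field \<mu> \<rightarrow> Field \<theta>"
  have c: "Card_order \<mu>" "infinite (Field \<mu>)"
    using \<mu>(1) unfolding singular_cardinal_def by blast+
  obtain K where K: "K \<subseteq> Field \<mu>" "cofinal K \<mu>" "cofinality \<mu> = |K|"
    "\<And>L. L \<subseteq> Field \<mu> \<Longrightarrow> cofinal L \<mu> \<Longrightarrow> |K| \<le>o |L|"
    using cofinality_witness[OF c] by metis
  have K_small: "|K| <o \<mu>"
    using \<mu>(1) K(3) unfolding singular_cardinal_def by simp
  have T: "|Field \<theta>| <o |K|"
    using ordLess_Field \<theta> K(3) by metis
  have T': "|Field \<theta>| <o \<mu>"
    by (rule ordLess_transitive[OF T K_small])
  obtain A B where AB: "A \<subseteq> Field (cardSuc \<mu>)" "Restr (cardSuc \<mu>) A =o \<alpha>"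
    "\<And>i. i \<in> K \<Longrightarrow> B i \<subseteq> Field \<mu>" "\<And>i. i \<in> K \<Longrightarrow> |underS \<mu> i| <o |B i|"
    and const: "\<And>i. i \<in> K \<Longrightarrow> const_on d (A \<times> B i)"
    using simultaneous_homogeneous_sets[OF c \<mu>(2) K(1,2) K_small T' \<alpha> d] by blast
  have full: "|\<Union>i\<in>K. B i| =o \<mu>"
    by (rule card_of_UNION_cofinal[OF c(1) K(2) AB(3,4)])
  show "\<exists>A B. A \<subseteq> Field (cardSuc \<mu>) \<and> Restr (cardSuc \<mu>) A =o \<alpha> \<and>
      B \<subseteq> Field \<mu> \<and> Restr \<mu> B =o \<mu> \<and> const_on d (A \<times> B)"
  proof (cases "A = {}")
    case True
    \<comment> \<open>No point of \<open>A\<close> assigns colours here, and the whole union serves.\<close>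
    have "Restr \<mu> (\<Union>i\<in>K. B i) =o \<mu>"
      using AB(3) by (intro Restr_ordIso_if_card_of_ordIso[OF c(1) _ full]) blast
    moreover have "(\<Union>i\<in>K. B i) \<subseteq> Field \<mu>"
      using AB(3) by blast
    moreover have "const_on d (A \<times> (\<Union>i\<in>K. B i))"
      using True unfolding const_on_def by simp
    ultimately show ?thesis
      using AB(1,2) by blast
  next
    case False
    then obtain a where a: "a \<in> A"
      by blast
    \<comment> \<open>On each \<open>B i\<close> all points of \<open>A\<close> give the same colour, so \<open>a\<close> determines the colour classes.\<close>
    define D where "D t = {y \<in> (\<Union>i\<in>K. B i). d (a, y) = t}" for t
    have "d (a, y) \<in> Field \<theta>" if "y \<in> (\<Union>i\<in>K. B i)" for y
      using that a AB(1,3) by (intro funcset_mem[OF d]) blast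
    hence "(\<Union>t\<in>Field \<theta>. D t) = (\<Union>i\<in>K. B i)"
      unfolding D_def by auto
    hence "|\<Union>t\<in>Field \<theta>. D t| =o \<mu>"
      using full by simp
    moreover have D_Field: "D t \<subseteq> Field \<mu>" for t
      using AB(3) unfolding D_def by blast
    ultimately obtain t where "|D t| =o \<mu>"
      using ex_member_of_full_card[OF c K(1,2,4) K_small T, of D] by blast
    hence "Restr \<mu> (D t) =o \<mu>"
      by (rule Restr_ordIso_if_card_of_ordIso[OF c(1) D_Field])
    moreover have "d (a', y) = t" if a': "a' \<in> A" and y: "y \<in> D t" for a' y
    proof -
      obtain i where i: "i \<in> K" "y \<in> B i" and dy: "d (a, y) = t"
        using y unfolding D_def by blast
      show ?thesis
        using const[OF i(1)] a a' i(2) dy unfolding const_on_def by force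
    qed
    hence "const_on d (A \<times> D t)"
      unfolding const_on_def by blast
    ultimately show ?thesis
      using AB(1,2) D_Field by blast
  qed
qed

theorem theorem2p2:
  fixes \<mu> :: "'a rel" and \<theta> :: "'b rel" and \<alpha> :: "'c rel"
  assumes "singular_cardinal \<mu>"
    and "limit_of_measurables \<mu>"
    and "Card_order \<theta>"
    and "Well_order \<alpha>"
  shows "(\<theta> =o natLeq_on 2 \<or> \<theta> <o cofinality \<mu> \<longrightarrow>
            polarized_partition (cardSuc \<mu>) \<mu> \<mu> \<mu> \<theta>) \<and>
         (\<alpha> <o cardSuc \<mu> \<and> \<theta> <o cofinality \<mu> \<longrightarrow>
            polarized_partition (cardSuc \<mu>) \<mu> \<alpha> \<mu> \<theta>) \<and>
         (\<theta> <o \<mu> \<and> \<alpha> <o cardSuc \<mu> \<longrightarrow>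
            (\<forall>d. d \<in> Field (cardSuc \<mu>) \<times> Field \<mu> \<rightarrow> Field \<theta> \<longrightarrow>
               (\<exists>A B. A \<subseteq> Field (cardSuc \<mu>) \<and> Restr (cardSuc \<mu>) A =o \<alpha> \<and>
                  (\<Union>i\<in>Field (cofinality \<mu>). B i) \<subseteq> Field \<mu> \<and>
                  Restr \<mu> (\<Union>i\<in>Field (cofinality \<mu>). B i) =o \<mu> \<and>
                  (\<forall>i\<in>Field (cofinality \<mu>). const_on d (A \<times> B i)))))"
proof -
  have c: "Card_order \<mu>" "infinite (Field \<mu>)"
    using assms(1) unfolding singular_cardinal_def by blast+
  obtain K where K: "K \<subseteq> Field \<mu>" "cofinal K \<mu>" "cofinality \<mu> = |K|"
    using cofinality_witness[OF c] by metis
  have K_small: "|K| <o \<mu>"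
    using assms(1) K(3) unfolding singular_cardinal_def by simp
  have "natLeq_on 2 <o cofinality \<mu>"
    unfolding K(3)
    by (rule finite_ordLess_infinite[OF natLeq_on_Well_order card_of_Well_order])
      (simp_all add: Field_natLeq_on Field_card_of cofinal_infinite[OF c K(1,2)])
  hence \<theta>: "\<theta> <o cofinality \<mu>" if "\<theta> =o natLeq_on 2 \<or> \<theta> <o cofinality \<mu>"
    using that ordIso_ordLess_trans by blast
  have wo: "Well_order \<mu>"
    using c(1) unfolding card_order_on_def by blast
  have "polarized_partition (cardSuc \<mu>) \<mu> \<mu> \<mu> \<theta>" if "\<theta> =o natLeq_on 2 \<or> \<theta> <o cofinality \<mu>"
    by (rule polarized_partition_below_cofinality[OF assms(1,2) \<theta>[OF that] wo cardSuc_greater[OF c(1)]])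
  moreover have "polarized_partition (cardSuc \<mu>) \<mu> \<alpha> \<mu> \<theta>"
    if "\<alpha> <o cardSuc \<mu>" "\<theta> <o cofinality \<mu>"
    by (rule polarized_partition_below_cofinality[OF assms(1,2) that(2) assms(4) that(1)])
  moreover have "\<exists>A B. A \<subseteq> Field (cardSuc \<mu>) \<and> Restr (cardSuc \<mu>) A =o \<alpha> \<and>
                  (\<Union>i\<in>Field (cofinality \<mu>). B i) \<subseteq> Field \<mu> \<and>
                  Restr \<mu> (\<Union>i\<in>Field (cofinality \<mu>). B i) =o \<mu> \<and>
                  (\<forall>i\<in>Field (cofinality \<mu>). const_on d (A \<times> B i))"
    if h: "\<theta> <o \<mu>" "\<alpha> <o cardSuc \<mu>" "d \<in> Field (cardSuc \<mu>) \<times> Field \<mu> \<rightarrow> Field \<theta>"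
    for d :: "'a set \<times> 'a \<Rightarrow> 'b"
  proof -
    obtain A B where AB: "A \<subseteq> Field (cardSuc \<mu>)" "Restr (cardSuc \<mu>) A =o \<alpha>"
      "\<And>i. i \<in> K \<Longrightarrow> B i \<subseteq> Field \<mu>" "\<And>i. i \<in> K \<Longrightarrow> |underS \<mu> i| <o |B i|"
      and const: "\<And>i. i \<in> K \<Longrightarrow> const_on d (A \<times> B i)"
      using simultaneous_homogeneous_sets[OF c assms(2) K(1,2) K_small ordLess_Field[OF h(1)]
          assms(4) h(2,3)] by blast
    have sub: "(\<Union>i\<in>K. B i) \<subseteq> Field \<mu>"
      using AB(3) by blast
    have "Restr \<mu> (\<Union>i\<in>K. B i) =o \<mu>"
      by (rule Restr_ordIso_if_card_of_ordIso[OF c(1) sub card_of_UNION_cofinal[OF c(1) K(2) AB(3,4)]])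
    thus ?thesis
      unfolding K(3) Field_card_of using AB(1,2) const sub by blast
  qed
  ultimately show ?thesis
    by blast
qed

end
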